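(* Let $(\mathbb{K},P)$ be an ordered field and $\mathbb{K}^c=\mathbb{K}(i)$, $i=\sqrt{-1}$. Let $V$ be a vector space of finite dimension $n$ over $\mathbb{K}^c$ with basis $e_1,\dots,e_n$, and let $\phi:V\times V\to\mathbb{K}^c$ be a non-negative definite hermitian form. Write $\phi_{jk}:=\phi(e_j,e_k)=a_{jk}+i\,b_{jk}$ with $a_{jk},b_{jk}\in\mathbb{K}$. Then $$\det(a_{jk})\ \geq\ \det(b_{jk}).$$ If $\phi$ is positive definite, then $\det(a_{jk})>\det(b_{jk})$. If $\det(a_{jk})=0$, then $\det(b_{jk})=0$.
   Context: An ordered field $(\mathbb{K},P)$ is a field $\mathbb{K}$ with a subset $P$ (the positive elements) such that $0\notin P$, $P\cap -P=\emptyset$, $P+P\subset P$, $P\cdot P\subset P$, $\mathbb{K}=P\cup\{0\}\cup -P$; $a>b$ means $a-b\in P$, and $a\ge b$ means $a>b$ or $a=b$. Then $-1$ is not a sum of squares in $\mathbb{K}$, and $\mathbb{K}^c=\mathbb{K}+i\mathbb{K}$ carries the conjugation $\overline{x+iy}=x-iy$ ($x,y\in\mathbb{K}$). A hermitian form on $V$ is a map $\phi:V\times V\to\mathbb{K}^c$ that is conjugate-linear in the first argument, linear in the second argument, and satisfies $\overline{\phi(v,w)}=\phi(w,v)$. It is positive definite if $\phi(v,v)>0$ for all nonzero $v\in V$, and non-negative definite if $\phi(v,v)\ge 0$ for all $v\in V$. (The matrix $(a_{jk})$ is symmetric and $(b_{jk})$ is skew-symmetric.) *)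

theory Defs
  imports Complex_Main "Jordan_Normal_Form.Determinant"
begin

text \<open>
  The quadratic extension \<open>K(i)\<close> of an ordered field \<open>K\<close>: \<open>Cext x y\<close> stands for \<open>x + i y\<close>.
  (The library type of complex numbers only covers the case where \<open>K\<close> is the field of reals.)
\<close>

datatype 'a cext = Cext (re_part: 'a) (im_part: 'a)

lemma cext_eq_iff: "z = w \<longleftrightarrow> re_part z = re_part w \<and> im_part z = im_part w"
  by (cases z; cases w) auto

instantiation cext :: (linordered_field) field
begin

definition "0 = Cext 0 0"
definition "1 = Cext 1 0"
definition "z + w = Cext (re_part z + re_part w) (im_part z + im_part w)"
definition "z - w = Cext (re_part z - re_part w) (im_part z - im_part w)"
definition "- z = Cext (- re_part z) (- im_part z)"
definition "z * w = Cext (re_part z * re_part w - im_part z * im_part w)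
                         (re_part z * im_part w + im_part z * re_part w)"
definition "inverse z = Cext (re_part z / ((re_part z)\<^sup>2 + (im_part z)\<^sup>2))
                             (- im_part z / ((re_part z)\<^sup>2 + (im_part z)\<^sup>2))"
definition "z div w = z * inverse (w :: 'a cext)"

instance
proof
  fix z :: "'a cext"
  assume "z \<noteq> 0"
  then have "(re_part z)\<^sup>2 + (im_part z)\<^sup>2 \<noteq> 0"
    by (simp add: cext_eq_iff zero_cext_def sum_power2_eq_zero_iff)
  then show "inverse z * z = 1"
    by (simp add: cext_eq_iff times_cext_def inverse_cext_def one_cext_def
        add_divide_distrib [symmetric] power2_eq_square)
qed (simp_all add: cext_eq_iff zero_cext_def one_cext_def plus_cext_def minus_cext_def
    uminus_cext_def times_cext_def inverse_cext_def divide_cext_def algebra_simps)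

end

definition of_base :: "'a::linordered_field \<Rightarrow> 'a cext" where
  "of_base x = Cext x 0"

definition imag_unit :: "'a::linordered_field cext" where
  "imag_unit = Cext 0 1"

definition conj_cext :: "'a::linordered_field cext \<Rightarrow> 'a cext" where
  "conj_cext z = of_base (re_part z) - imag_unit * of_base (im_part z)"

lemma of_base_hom:
  "of_base 0 = 0" "of_base 1 = 1"
  "of_base (x + y) = of_base x + of_base y" "of_base (x * y) = of_base x * of_base y"
  by (simp_all add: of_base_def zero_cext_def one_cext_def plus_cext_def times_cext_def)

lemma imag_unit_square: "imag_unit * imag_unit = (- 1 :: 'a::linordered_field cext)"
  by (simp add: imag_unit_def times_cext_def one_cext_def uminus_cext_def)

lemma cext_decomp: "z = of_base (re_part z) + imag_unit * of_base (im_part z)"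
  by (simp add: cext_eq_iff of_base_def imag_unit_def plus_cext_def times_cext_def)

definition hermitian_form ::
  "('a::linordered_field cext \<Rightarrow> 'v::ab_group_add \<Rightarrow> 'v) \<Rightarrow> ('v \<Rightarrow> 'v \<Rightarrow> 'a cext) \<Rightarrow> bool" where
  "hermitian_form scale \<phi> \<longleftrightarrow>
     (\<forall>u v w. \<phi> (u + v) w = \<phi> u w + \<phi> v w) \<and>
     (\<forall>c v w. \<phi> (scale c v) w = conj_cext c * \<phi> v w) \<and>
     (\<forall>u v w. \<phi> u (v + w) = \<phi> u v + \<phi> u w) \<and>
     (\<forall>c v w. \<phi> v (scale c w) = c * \<phi> v w) \<and>
     (\<forall>v w. conj_cext (\<phi> v w) = \<phi> w v)"

text \<open>
  The extension field carries no order; an inequality such as \<open>\<phi> v v > 0\<close> means that \<open>\<phi> v v\<close>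
  is (the image of) an element of the base field satisfying it.
\<close>

definition positive_definite :: "('v::ab_group_add \<Rightarrow> 'v \<Rightarrow> 'a::linordered_field cext) \<Rightarrow> bool" where
  "positive_definite \<phi> \<longleftrightarrow> (\<forall>v. v \<noteq> 0 \<longrightarrow> (\<exists>r. r > 0 \<and> \<phi> v v = of_base r))"

definition nonneg_definite :: "('v::ab_group_add \<Rightarrow> 'v \<Rightarrow> 'a::linordered_field cext) \<Rightarrow> bool" where
  "nonneg_definite \<phi> \<longleftrightarrow> (\<forall>v. \<exists>r. r \<ge> 0 \<and> \<phi> v v = of_base r)"

end

theory Submission
  imports Defs
begin

text \<open>
  Let \<open>A\<close> and \<open>B\<close> be the real and imaginary parts of the Gram matrix of \<open>\<phi>\<close>. Evaluated at the
  vector with coordinates \<open>y + i x\<close>, the form gives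
  \<open>h(x, y) = x\<^sup>T A x + y\<^sup>T A y + 2 x\<^sup>T B y\<close>, which is thus non-negative for all \<open>x\<close>, \<open>y\<close> over the
  base field. Only this inequality enters the comparison of the determinants.

  If \<open>A\<close> is singular, then \<open>A y = 0\<close> for some \<open>y \<noteq> 0\<close>. For this \<open>y\<close> the term of \<open>h\<close> that is
  linear in \<open>x\<close> must vanish, so \<open>B y = 0\<close> and \<open>det B = 0\<close> (\<open>kernel_of_real_part\<close>).

  If \<open>A\<close> is invertible, solve \<open>A X = - B\<close> and put \<open>C = X\<^sup>T A X\<close>. Substituting \<open>x = X y\<close> turns \<open>h\<close>
  into \<open>y\<^sup>T A y - y\<^sup>T C y\<close>, so \<open>0 \<le> C \<le> A\<close> as quadratic forms. The determinant is monotone on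
  non-negative forms (\<open>det_mono_quad_form\<close>), whence \<open>det A (det X)\<^sup>2 \<le> det A\<close>. Therefore
  \<open>\<bar>det X\<bar> \<le> 1\<close> and \<open>\<bar>det B\<bar> = det A \<bar>det X\<bar> \<le> det A\<close>. If \<open>\<phi>\<close> is positive definite, then \<open>C < A\<close>
  and all inequalities become strict (\<open>det_strict_mono_quad_form\<close>).

  Over an ordered field there are in general neither square roots nor eigenvalues, so the
  monotonicity of the determinant is proved by induction on the size of the matrices, by passing to
  Schur complements: the Schur complement of a form is what remains after minimising over the first
  coordinate. It therefore respects the order of forms, and it splits the corner entry off the
  determinant.
\<close>

section \<open>Quadratic forms and Schur complements\<close>

definition quad_form :: "nat \<Rightarrow> (nat \<Rightarrow> nat \<Rightarrow> 'a::linordered_field) \<Rightarrow> (nat \<Rightarrow> 'a) \<Rightarrow> 'a" where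
  "quad_form n a x = (\<Sum>j<n. \<Sum>k<n. x j * a j k * x k)"

abbreviation sq_mat :: "nat \<Rightarrow> (nat \<Rightarrow> nat \<Rightarrow> 'a) \<Rightarrow> 'a mat" where
  "sq_mat n a \<equiv> mat n n (\<lambda>(j, k). a j k)"

text \<open>The Schur complement of the corner entry, re-indexed to start at \<open>0\<close> again.\<close>

definition schur :: "(nat \<Rightarrow> nat \<Rightarrow> 'a::linordered_field) \<Rightarrow> nat \<Rightarrow> nat \<Rightarrow> 'a" where
  "schur a j k = a (Suc j) (Suc k) - a (Suc j) 0 * a 0 (Suc k) / a 0 0"

lemma quad_form_scale: "quad_form n a (\<lambda>j. t * x j) = t\<^sup>2 * quad_form n a x"
  unfolding quad_form_def by (simp add: sum_distrib_left power2_eq_square mult_ac)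

text \<open>
  Isolating the first coordinate displays the form as a quadratic polynomial in it; completing the
  square below then produces the Schur complement.
\<close>

lemma quad_form_Suc:
  assumes sym: "\<And>j k. j < Suc n \<Longrightarrow> k < Suc n \<Longrightarrow> a j k = a k j"
  shows "quad_form (Suc n) a x = a 0 0 * (x 0)\<^sup>2
    + 2 * x 0 * (\<Sum>k<n. a 0 (Suc k) * x (Suc k))
    + quad_form n (\<lambda>j k. a (Suc j) (Suc k)) (\<lambda>j. x (Suc j))"
proof -
  have "(\<Sum>j<n. x (Suc j) * a (Suc j) 0 * x 0) = x 0 * (\<Sum>k<n. a 0 (Suc k) * x (Suc k))"
    unfolding sum_distrib_left by (intro sum.cong refl) (use sym in auto)
  moreover have "(\<Sum>k<n. x 0 * a 0 (Suc k) * x (Suc k)) = x 0 * (\<Sum>k<n. a 0 (Suc k) * x (Suc k))"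
    by (simp add: sum_distrib_left mult_ac)
  ultimately show ?thesis
    unfolding quad_form_def sum.lessThan_Suc_shift by (simp add: sum.distrib power2_eq_square)
qed

lemma quad_form_complete_square:
  assumes sym: "\<And>j k. j < Suc n \<Longrightarrow> k < Suc n \<Longrightarrow> a j k = a k j" and "a 0 0 \<noteq> 0"
  shows "quad_form (Suc n) a x
    = a 0 0 * (x 0 + (\<Sum>k<n. a 0 (Suc k) * x (Suc k)) / a 0 0)\<^sup>2
      + quad_form n (schur a) (\<lambda>j. x (Suc j))"
proof -
  let ?l = "\<Sum>k<n. a 0 (Suc k) * x (Suc k)"
  have "(\<Sum>j<n. \<Sum>k<n. x (Suc j) * (a (Suc j) 0 * a 0 (Suc k) / a 0 0) * x (Suc k)) = ?l * ?l / a 0 0"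
    unfolding sum_product sum_divide_distrib
    by (intro sum.cong refl) (use sym in \<open>auto simp: mult_ac\<close>)
  then have "quad_form n (schur a) (\<lambda>j. x (Suc j))
      = quad_form n (\<lambda>j k. a (Suc j) (Suc k)) (\<lambda>j. x (Suc j)) - ?l * ?l / a 0 0"
    unfolding quad_form_def schur_def by (simp add: algebra_simps sum_subtractf)
  moreover have "quad_form (Suc n) a x = a 0 0 * (x 0)\<^sup>2 + 2 * x 0 * ?l
      + quad_form n (\<lambda>j k. a (Suc j) (Suc k)) (\<lambda>j. x (Suc j))"
    by (rule quad_form_Suc[OF sym])
  moreover have "a 0 0 * (x 0 + ?l / a 0 0)\<^sup>2 = a 0 0 * (x 0)\<^sup>2 + 2 * x 0 * ?l + ?l * ?l / a 0 0"
    using assms(2) by (simp add: power2_eq_square field_simps)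
  ultimately show ?thesis by simp
qed

text \<open>
  One step of Gaussian elimination: a unipotent lower triangular factor clears the first column.
\<close>

lemma det_schur:
  assumes "a 0 0 \<noteq> 0"
  shows "det (sq_mat (Suc n) a) = a 0 0 * det (sq_mat n (schur a))"
proof -
  define P where "P = mat 1 1 (\<lambda>_. a 0 0)"
  define R where "R = mat 1 n (\<lambda>(_ :: nat, k). a 0 (Suc k))"
  define L where "L = mat n 1 (\<lambda>(j, _ :: nat). a (Suc j) 0 / a 0 0)"
  define S where "S = sq_mat n (schur a)"
  have carrier: "P \<in> carrier_mat 1 1" "R \<in> carrier_mat 1 n" "L \<in> carrier_mat n 1"
    "S \<in> carrier_mat n n"
    by (simp_all add: P_def R_def L_def S_def)
  note [simp] = carrier carrier[unfolded One_nat_def]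
  have LP: "L * P = mat n 1 (\<lambda>(j, _ :: nat). a (Suc j) 0)"
    using assms by (intro eq_matI) (auto simp: L_def P_def scalar_prod_def)
  have LR: "L * R + S = mat n n (\<lambda>(j, k). a (Suc j) (Suc k))"
    by (intro eq_matI) (auto simp: L_def R_def S_def scalar_prod_def schur_def)
  have "four_block_mat (1\<^sub>m 1) (0\<^sub>m 1 n) L (1\<^sub>m n) * four_block_mat P R (0\<^sub>m n 1) S
      = four_block_mat P R (L * P) (L * R + S)"
    by (subst mult_four_block_mat[OF one_carrier_mat zero_carrier_mat carrier(3) one_carrier_mat
          carrier(1,2) zero_carrier_mat carrier(4)])
      (simp only: left_mult_one_mat[OF carrier(1)] left_mult_one_mat[OF carrier(2)]
        left_mult_one_mat[OF carrier(4)] left_mult_zero_mat[OF carrier(4)]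
        left_mult_zero_mat[OF zero_carrier_mat] right_mult_zero_mat[OF one_carrier_mat]
        right_add_zero_mat[OF carrier(1)] right_add_zero_mat[OF carrier(2)]
        right_add_zero_mat[OF mult_carrier_mat[OF carrier(3,1)]])
  also have "\<dots> = sq_mat (Suc n) a"
    unfolding LP LR by (intro eq_matI) (auto simp: P_def R_def gr0_conv_Suc less_Suc_eq_0_disj)
  finally have "det (sq_mat (Suc n) a)
      = det (four_block_mat (1\<^sub>m 1) (0\<^sub>m 1 n) L (1\<^sub>m n) * four_block_mat P R (0\<^sub>m n 1) S)"
    by simp
  also have "\<dots> = det (four_block_mat (1\<^sub>m 1) (0\<^sub>m 1 n) L (1\<^sub>m n)) * det (four_block_mat P R (0\<^sub>m n 1) S)"
    by (rule det_mult[of _ "1 + n"]; rule four_block_carrier_mat; simp)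
  also have "det (four_block_mat (1\<^sub>m 1) (0\<^sub>m 1 n) L (1\<^sub>m n)) = det (1\<^sub>m 1 :: 'a mat) * det (1\<^sub>m n :: 'a mat)"
    by (rule det_four_block_mat_upper_right_zero[OF one_carrier_mat refl carrier(3) one_carrier_mat])
  also have "det (four_block_mat P R (0\<^sub>m n 1) S) = det P * det S"
    by (rule det_four_block_mat_lower_left_zero[OF carrier(1,2) refl carrier(4)])
  also have "det P = a 0 0" by (simp add: det_single P_def)
  finally show ?thesis by (simp add: S_def)
qed

lemma schur_sym:
  assumes "\<And>j k. j < Suc n \<Longrightarrow> k < Suc n \<Longrightarrow> a j k = a k j" "j < n" "k < n"
  shows "schur a j k = schur a k j"
  using assms by (simp add: schur_def mult_ac)

text \<open>
  By completion of squares, \<open>quad_form n (schur a) y\<close> is the minimum of the form of \<open>a\<close> over the first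
  coordinate, with \<open>y\<close> filling the remaining ones. At the minimiser for \<open>f\<close>, the form of \<open>c\<close> is
  at least its own minimum and at most the minimum for \<open>f\<close>.
\<close>

lemma quad_form_schur_mono:
  assumes symc: "\<And>j k. j < Suc n \<Longrightarrow> k < Suc n \<Longrightarrow> c j k = c k j"
    and symf: "\<And>j k. j < Suc n \<Longrightarrow> k < Suc n \<Longrightarrow> f j k = f k j"
    and le: "\<And>x. quad_form (Suc n) c x \<le> quad_form (Suc n) f x"
    and c: "c 0 0 > 0" and f: "f 0 0 > 0"
  shows "quad_form n (schur c) y \<le> quad_form n (schur f) y"
proof -
  \<comment> \<open>the first coordinate that makes the completed square in the form of \<open>f\<close> vanish\<close>
  define x where "x = case_nat (- (\<Sum>k<n. f 0 (Suc k) * y k) / f 0 0) y"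
  have "quad_form n (schur c) y \<le> quad_form (Suc n) c x"
    using c by (subst quad_form_complete_square[where a = c, OF symc]) (auto simp: x_def)
  also have "\<dots> \<le> quad_form (Suc n) f x" by (rule le)
  also have "\<dots> = quad_form n (schur f) y"
    using f by (subst quad_form_complete_square[where a = f, OF symf]) (auto simp: x_def)
  finally show ?thesis .
qed

lemma quad_form_schur_nonneg:
  assumes sym: "\<And>j k. j < Suc n \<Longrightarrow> k < Suc n \<Longrightarrow> f j k = f k j"
    and nonneg: "\<And>x. 0 \<le> quad_form (Suc n) f x"
    and f: "f 0 0 > 0"
  shows "0 \<le> quad_form n (schur f) y"
proof -
  define x where "x = case_nat (- (\<Sum>k<n. f 0 (Suc k) * y k) / f 0 0) y"
  have "0 \<le> quad_form (Suc n) f x" by (rule nonneg)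
  also have "\<dots> = quad_form n (schur f) y"
    using f by (subst quad_form_complete_square[where a = f, OF sym]) (auto simp: x_def)
  finally show ?thesis .
qed

section \<open>Monotonicity of the determinant\<close>

text \<open>
  A quadratic polynomial without constant term takes negative values near \<open>0\<close> unless its linear
  term vanishes too. The witness is \<open>- z / (q + 1)\<close>; the added \<open>1\<close> allows \<open>q = 0\<close>.
\<close>

lemma linear_term_zero:
  fixes q z :: "'a::linordered_field"
  assumes "\<And>t. 0 \<le> q * t\<^sup>2 + 2 * z * t"
  shows "z = 0"
proof (rule ccontr)
  assume z: "z \<noteq> 0"
  have q: "q \<ge> 0" using assms[of 1] assms[of "-1"] by simp
  define t where "t = - z / (q + 1)"
  have zt: "z = - (t * (q + 1))" and t: "t \<noteq> 0" using q z by (auto simp: t_def)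
  have "q * t\<^sup>2 + 2 * z * t = - ((q + 2) * t\<^sup>2)"
    unfolding zt by (simp add: algebra_simps power2_eq_square)
  moreover have "(q + 2) * t\<^sup>2 > 0" using q t by simp
  ultimately show False using assms[of t] by simp
qed

text \<open>
  The first basis vector is isotropic, hence orthogonal to everything. The orthogonality is tested
  against the row \<open>r\<close> itself, which makes the linear term a sum of squares.
\<close>

lemma zero_corner_imp_zero_row:
  assumes sym: "\<And>j k. j < Suc n \<Longrightarrow> k < Suc n \<Longrightarrow> c j k = c k j"
    and nonneg: "\<And>x. 0 \<le> quad_form (Suc n) c x"
    and c0: "c 0 0 = 0" and k: "k < n"
  shows "c 0 (Suc k) = 0"
proof -
  let ?r = "\<lambda>k. c 0 (Suc k)" and ?d = "\<lambda>j k. c (Suc j) (Suc k)"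
  have "0 \<le> quad_form n ?d ?r * t\<^sup>2 + 2 * (\<Sum>k<n. (?r k)\<^sup>2) * t" for t
    using nonneg[of "case_nat 1 (\<lambda>k. t * ?r k)"]
    by (simp add: quad_form_Suc[where a = c, OF sym] c0 quad_form_scale sum_distrib_left
        power2_eq_square mult_ac)
  then have "(\<Sum>k<n. (?r k)\<^sup>2) = 0" by (rule linear_term_zero)
  then show ?thesis using k by (simp add: sum_nonneg_eq_0_iff)
qed

lemma quad_form_unit:
  assumes "\<And>j k. j < Suc n \<Longrightarrow> k < Suc n \<Longrightarrow> a j k = a k j"
  shows "quad_form (Suc n) a (\<lambda>j. if j = 0 then 1 else 0) = a 0 0"
  by (subst quad_form_Suc[where a = a, OF assms]) (auto simp: quad_form_def)

lemma det_zero_row: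
  assumes "\<And>k. k < Suc n \<Longrightarrow> a 0 k = 0"
  shows "det (sq_mat (Suc n) a) = 0"
  by (subst laplace_expansion_row[of _ "Suc n" 0]) (auto simp: assms intro!: sum.neutral)

lemma zero_corner_imp_det_zero:
  assumes sym: "\<And>j k. j < Suc n \<Longrightarrow> k < Suc n \<Longrightarrow> c j k = c k j"
    and nonneg: "\<And>x. 0 \<le> quad_form (Suc n) c x"
    and c0: "c 0 0 = 0"
  shows "det (sq_mat (Suc n) c) = 0"
proof (rule det_zero_row)
  fix k assume "k < Suc n"
  then show "c 0 k = 0"
    using zero_corner_imp_zero_row[OF sym nonneg c0] c0 by (cases k) auto
qed

text \<open>
  If both corners are positive, both determinants factor through their Schur complements, and
  corners and complements are ordered in the same way as the forms. If the corner of \<open>c\<close> vanishes,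
  then \<open>det c = 0\<close>, and it remains to see that \<open>det f\<close> is non-negative: it vanishes if
  the corner of \<open>f\<close> does, and otherwise the induction hypothesis applies to the pair consisting of
  the Schur complement of \<open>f\<close> and itself.
\<close>

lemma det_mono_quad_form:
  assumes "\<And>j k. j < n \<Longrightarrow> k < n \<Longrightarrow> c j k = c k j"
    and "\<And>j k. j < n \<Longrightarrow> k < n \<Longrightarrow> f j k = f k j"
    and "\<And>x. 0 \<le> quad_form n c x"
    and "\<And>x. quad_form n c x \<le> quad_form n f x"
  shows "0 \<le> det (sq_mat n c) \<and> det (sq_mat n c) \<le> det (sq_mat n f)"
  using assms
proof (induction n arbitrary: c f)
  case 0
  then show ?case by simp
next
  case (Suc n)
  note symc = Suc.prems(1) and symf = Suc.prems(2) and c_nn = Suc.prems(3) and le = Suc.prems(4)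
  have f_nn: "0 \<le> quad_form (Suc n) f x" for x using c_nn[of x] le[of x] by linarith
  have c0: "0 \<le> c 0 0" and cf0: "c 0 0 \<le> f 0 0"
    using c_nn[of "\<lambda>j. if j = 0 then 1 else 0"] le[of "\<lambda>j. if j = 0 then 1 else 0"]
      quad_form_unit[where a = c, OF symc] quad_form_unit[where a = f, OF symf] by auto
  show ?case
  proof (cases "c 0 0 = 0")
    case True
    then have "det (sq_mat (Suc n) c) = 0"
      using zero_corner_imp_det_zero[of n c] symc c_nn by blast
    moreover have "0 \<le> det (sq_mat (Suc n) f)"
    proof (cases "f 0 0 = 0")
      case True
      then show ?thesis
        using zero_corner_imp_det_zero[of n f] symf f_nn by simp
    next
      case False
      with c0 cf0 have f0: "f 0 0 > 0" by simp
      have "0 \<le> det (sq_mat n (schur f))"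
        using Suc.IH[of "schur f" "schur f"] schur_sym[of n f] symf
          quad_form_schur_nonneg[OF symf f_nn f0] by blast
      then show ?thesis using f0 det_schur[of f n] by simp
    qed
    ultimately show ?thesis by simp
  next
    case False
    with c0 cf0 have c0: "c 0 0 > 0" and f0: "f 0 0 > 0" by auto
    have "0 \<le> det (sq_mat n (schur c)) \<and> det (sq_mat n (schur c)) \<le> det (sq_mat n (schur f))"
    proof (rule Suc.IH)
      show "0 \<le> quad_form n (schur c) y" for y
        by (rule quad_form_schur_nonneg[OF symc c_nn c0])
      show "quad_form n (schur c) y \<le> quad_form n (schur f) y" for y
        by (rule quad_form_schur_mono[OF symc symf le c0 f0])
    qed (use schur_sym[of n c] schur_sym[of n f] symc symf in blast)+
    then show ?thesis
      using c0 f0 cf0 det_schur[of c n] det_schur[of f n] by (auto intro!: mult_mono)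
  qed
qed

lemma det_zero_iff_kernel:
  "det (sq_mat n (a :: nat \<Rightarrow> nat \<Rightarrow> 'a::linordered_field)) = 0 \<longleftrightarrow>
    (\<exists>y. (\<exists>j<n. y j \<noteq> 0) \<and> (\<forall>j<n. (\<Sum>k<n. a j k * y k) = 0))"
proof -
  have mv: "(sq_mat n a *\<^sub>v v = 0\<^sub>v n) \<longleftrightarrow> (\<forall>j<n. (\<Sum>k<n. a j k * v $ k) = 0)"
    if "v \<in> carrier_vec n" for v
    using that by (auto simp: vec_eq_iff scalar_prod_def atLeast0LessThan)
  show ?thesis
    unfolding det_0_iff_vec_prod_zero[of "sq_mat n a" n, simplified]
  proof safe
    fix v :: "'a vec" assume v: "v \<in> carrier_vec n" "v \<noteq> 0\<^sub>v n" "sq_mat n a *\<^sub>v v = 0\<^sub>v n"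
    then show "\<exists>y. (\<exists>j<n. y j \<noteq> 0) \<and> (\<forall>j<n. (\<Sum>k<n. a j k * y k) = 0)"
      using mv[of v] by (intro exI[of _ "\<lambda>j. v $ j"]) (auto simp: vec_eq_iff)
  next
    fix y j assume y: "j < n" "y j \<noteq> 0" "\<forall>j<n. (\<Sum>k<n. a j k * y k) = 0"
    then show "\<exists>v. v \<in> carrier_vec n \<and> v \<noteq> 0\<^sub>v n \<and> sq_mat n a *\<^sub>v v = 0\<^sub>v n"
      using mv[of "vec n y"] by (intro exI[of _ "vec n y"]) (auto simp: vec_eq_iff)
  qed
qed

lemma det_nonzero_if_positive:
  assumes "\<And>x. \<exists>j<n. x j \<noteq> 0 \<Longrightarrow> 0 < quad_form n a x"
  shows "det (sq_mat n a) \<noteq> 0"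
proof
  assume "det (sq_mat n a) = 0"
  then obtain y where y: "\<exists>j<n. y j \<noteq> 0" "\<And>j. j < n \<Longrightarrow> (\<Sum>k<n. a j k * y k) = 0"
    unfolding det_zero_iff_kernel by blast
  have "quad_form n a y = (\<Sum>j<n. y j * (\<Sum>k<n. a j k * y k))"
    by (simp add: quad_form_def sum_distrib_left mult_ac)
  also have "\<dots> = 0" using y(2) by simp
  finally show False using assms[OF y(1)] by simp
qed

text \<open>
  Non-strict monotonicity suffices for the Schur complements: strictness already comes from the
  corner entries \<open>c 0 0 < f 0 0\<close>, because the factor \<open>det (schur f)\<close> is positive.
\<close>

lemma det_strict_mono_quad_form:
  assumes symc: "\<And>j k. j < n \<Longrightarrow> k < n \<Longrightarrow> c j k = c k j"
    and symf: "\<And>j k. j < n \<Longrightarrow> k < n \<Longrightarrow> f j k = f k j"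
    and c_nn: "\<And>x. 0 \<le> quad_form n c x"
    and less: "\<And>x. \<exists>j<n. x j \<noteq> 0 \<Longrightarrow> quad_form n c x < quad_form n f x"
    and "n \<ge> 1"
  shows "det (sq_mat n c) < det (sq_mat n f)"
proof -
  have le: "quad_form n c x \<le> quad_form n f x" for x
  proof (cases "\<exists>j<n. x j \<noteq> 0")
    case True
    then show ?thesis using less by (simp add: less_imp_le)
  next
    case False
    then show ?thesis by (simp add: quad_form_def)
  qed
  have pos: "0 < quad_form n f x" if "\<exists>j<n. x j \<noteq> 0" for x
    using less[OF that] c_nn[of x] by linarith
  have nz: "det (sq_mat n f) \<noteq> 0" by (rule det_nonzero_if_positive[OF pos])
  have mono: "0 \<le> det (sq_mat n c) \<and> det (sq_mat n c) \<le> det (sq_mat n f)"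
    by (rule det_mono_quad_form[OF symc symf c_nn le])
  show ?thesis
  proof (cases "det (sq_mat n c) = 0")
    case True
    with nz mono show ?thesis by simp
  next
    case False
    obtain m where n: "n = Suc m" using \<open>n \<ge> 1\<close> by (cases n) auto
    note symc = symc[unfolded n] and symf = symf[unfolded n] and c_nn = c_nn[unfolded n]
      and le = le[unfolded n]
    have c0: "c 0 0 \<ge> 0" using c_nn[of "\<lambda>j. if j = 0 then 1 else 0"]
        quad_form_unit[where a = c, OF symc] by simp
    have "c 0 0 \<noteq> 0"
    proof
      assume "c 0 0 = 0"
      then have "det (sq_mat (Suc m) c) = 0"
        using zero_corner_imp_det_zero[of m c] symc c_nn by blast
      with False show False by (simp add: n)
    qed
    with c0 have c0: "c 0 0 > 0" by simp
    have cf: "c 0 0 < f 0 0"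
      using less[of "\<lambda>j. if j = 0 then 1 else 0"] quad_form_unit[where a = c, OF symc]
        quad_form_unit[where a = f, OF symf] by (auto simp: n)
    then have f0: "f 0 0 > 0" using c0 by simp
    have S: "0 \<le> det (sq_mat m (schur c)) \<and> det (sq_mat m (schur c)) \<le> det (sq_mat m (schur f))"
    proof (rule det_mono_quad_form)
      show "0 \<le> quad_form m (schur c) y" for y
        by (rule quad_form_schur_nonneg[OF symc c_nn c0])
      show "quad_form m (schur c) y \<le> quad_form m (schur f) y" for y
        by (rule quad_form_schur_mono[OF symc symf le c0 f0])
    qed (use schur_sym[of m c] schur_sym[of m f] symc symf in blast)+
    have "det (sq_mat m (schur f)) \<noteq> 0" using nz det_schur[of f m] f0 by (simp add: n)
    with S have "c 0 0 * det (sq_mat m (schur c)) \<le> c 0 0 * det (sq_mat m (schur f))"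
      "c 0 0 * det (sq_mat m (schur f)) < f 0 0 * det (sq_mat m (schur f))"
      using c0 cf by auto
    then have "c 0 0 * det (sq_mat m (schur c)) < f 0 0 * det (sq_mat m (schur f))"
      by (rule le_less_trans)
    then show ?thesis using det_schur[of c m] det_schur[of f m] c0 f0 by (simp add: n)
  qed
qed


section \<open>Comparison of the real and imaginary parts\<close>

lemma quad_form_bilinear: "quad_form n a x = (\<Sum>j<n. x j * (\<Sum>k<n. a j k * x k))"
  by (simp add: quad_form_def sum_distrib_left mult_ac)

text \<open>
  For \<open>y\<close> in the kernel of \<open>a\<close> the hypothesis reads \<open>0 \<le> x\<^sup>T a x + 2 x\<^sup>T b y\<close>. Testing it on multiples
  of \<open>x = b y\<close> makes the linear term a sum of squares, which has to vanish.
\<close>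

lemma kernel_of_real_part:
  fixes a b :: "nat \<Rightarrow> nat \<Rightarrow> 'a::linordered_field"
  assumes nonneg: "\<And>x y. 0 \<le> quad_form n a x + quad_form n a y
      + 2 * (\<Sum>j<n. x j * (\<Sum>k<n. b j k * y k))"
    and ay: "\<And>j. j < n \<Longrightarrow> (\<Sum>k<n. a j k * y k) = 0"
    and j: "j < n"
  shows "(\<Sum>k<n. b j k * y k) = 0"
proof -
  define z where "z j = (\<Sum>k<n. b j k * y k)" for j
  have "quad_form n a y = 0" using ay by (simp add: quad_form_bilinear)
  then have "0 \<le> quad_form n a z * t\<^sup>2 + 2 * (\<Sum>j<n. (z j)\<^sup>2) * t" for t
    using nonneg[of "\<lambda>j. t * z j" y, folded z_def]
    by (simp add: quad_form_scale sum_distrib_left power2_eq_square mult_ac)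
  then have "(\<Sum>j<n. (z j)\<^sup>2) = 0" by (rule linear_term_zero)
  then show ?thesis using j by (simp add: sum_nonneg_eq_0_iff z_def)
qed

lemma solve_matrix_equation:
  fixes a b :: "nat \<Rightarrow> nat \<Rightarrow> 'a::field"
  assumes "det (sq_mat n a) \<noteq> 0"
  obtains X where "X \<in> carrier_mat n n" "sq_mat n a * X = sq_mat n b"
proof -
  obtain A' where A': "A' \<in> carrier_mat n n" "sq_mat n a * A' = 1\<^sub>m n"
    using det_non_zero_imp_unit[of "sq_mat n a" n, OF _ assms]
    by (auto simp: Units_def ring_mat_def)
  have "sq_mat n a * (A' * sq_mat n b) = sq_mat n b"
    by (subst assoc_mult_mat[symmetric, of _ n n _ n _ n]) (use A' in auto)
  then show ?thesis using that[of "A' * sq_mat n b"] A' by auto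
qed

lemma quad_form_scalar_prod:
  "quad_form n a x = vec n x \<bullet> (sq_mat n a *\<^sub>v vec n x)"
  by (simp add: quad_form_bilinear scalar_prod_def atLeast0LessThan)

lemma quad_form_congruence:
  fixes a :: "nat \<Rightarrow> nat \<Rightarrow> 'a::linordered_field"
  assumes X: "X \<in> carrier_mat n n"
  shows "quad_form n (\<lambda>j k. (X\<^sup>T * sq_mat n a * X) $$ (j, k)) y
    = quad_form n a (\<lambda>j. (X *\<^sub>v vec n y) $ j)"
proof -
  let ?A = "sq_mat n a" and ?y = "vec n y"
  have Xy: "X *\<^sub>v ?y \<in> carrier_vec n" using X by auto
  have "sq_mat n (\<lambda>j k. (X\<^sup>T * ?A * X) $$ (j, k)) = X\<^sup>T * ?A * X"
    using X by (intro eq_matI) auto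
  moreover have "vec n (\<lambda>j. (X *\<^sub>v ?y) $ j) = X *\<^sub>v ?y"
    using X by auto
  moreover have "X\<^sup>T * ?A * X *\<^sub>v ?y = X\<^sup>T *\<^sub>v (?A *\<^sub>v (X *\<^sub>v ?y))"
    using X by (simp add: assoc_mult_mat_vec[of _ n n _ n])
  moreover have "?y \<bullet> (X\<^sup>T *\<^sub>v u) = (X *\<^sub>v ?y) \<bullet> u" if u: "u \<in> carrier_vec n" for u
  proof -
    have "?y \<bullet> (X\<^sup>T *\<^sub>v u) = (X\<^sup>T *\<^sub>v u) \<bullet> ?y"
      by (rule comm_scalar_prod[of _ n]) (use X u in auto)
    also have "\<dots> = u \<bullet> (X *\<^sub>v ?y)"
      by (rule transpose_vec_mult_scalar[OF X _ u]) simp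
    also have "\<dots> = (X *\<^sub>v ?y) \<bullet> u"
      by (rule comm_scalar_prod[OF u Xy])
    finally show ?thesis .
  qed
  moreover have "?A *\<^sub>v (X *\<^sub>v ?y) \<in> carrier_vec n"
    by (rule mult_mat_vec_carrier[OF _ Xy]) simp
  ultimately show ?thesis unfolding quad_form_scalar_prod by simp
qed

text \<open>
  The heart of the argument. It is the block inequality
  \<open>det(b)\<^sup>2 \<le> det(a) det(d)\<close> for a non-negative symmetric matrix with diagonal blocks \<open>a\<close>, \<open>d\<close> and
  off-diagonal block \<open>b\<close>, in the case \<open>d = a\<close>. The matrix \<open>c\<close> in the proof is
  \<open>b\<^sup>T a\<inverse> b\<close>, and \<open>a - c\<close> is the Schur complement of the block \<open>a\<close>.
\<close>

lemma abs_det_imag_le_det_real: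
  fixes a b :: "nat \<Rightarrow> nat \<Rightarrow> 'a::linordered_field"
  assumes sym: "\<And>j k. j < n \<Longrightarrow> k < n \<Longrightarrow> a j k = a k j"
    and nonneg: "\<And>x y. 0 \<le> quad_form n a x + quad_form n a y
      + 2 * (\<Sum>j<n. x j * (\<Sum>k<n. b j k * y k))"
  shows "\<bar>det (sq_mat n b)\<bar> \<le> det (sq_mat n a)"
    and "\<lbrakk>n \<ge> 1; \<And>x y. \<exists>j<n. y j \<noteq> 0 \<Longrightarrow> 0 < quad_form n a x + quad_form n a y
      + 2 * (\<Sum>j<n. x j * (\<Sum>k<n. b j k * y k))\<rbrakk>
      \<Longrightarrow> \<bar>det (sq_mat n b)\<bar> < det (sq_mat n a)"
proof -
  let ?A = "sq_mat n a" and ?B = "sq_mat n b"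
  let ?h = "\<lambda>x y. quad_form n a x + quad_form n a y + 2 * (\<Sum>j<n. x j * (\<Sum>k<n. b j k * y k))"
  have a_nn: "0 \<le> quad_form n a x" for x
    using nonneg[of "\<lambda>_. 0" x] by (simp add: quad_form_def)
  have det_nn: "0 \<le> det ?A"
    using det_mono_quad_form[OF sym sym a_nn order_refl] by blast
  have pos: "det ?A \<noteq> 0" if "\<And>x y. \<exists>j<n. y j \<noteq> 0 \<Longrightarrow> 0 < ?h x y"
  proof (rule det_nonzero_if_positive)
    fix y assume "\<exists>j<n. y j \<noteq> (0::'a)"
    then show "0 < quad_form n a y"
      using that[of y "\<lambda>_. 0"] by (simp add: quad_form_def)
  qed
  have singular: "det ?B = 0" if "det ?A = 0"
    using that kernel_of_real_part[OF nonneg] unfolding det_zero_iff_kernel by blast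
  have regular: "\<bar>det ?B\<bar> \<le> det ?A \<and>
      (n \<ge> 1 \<and> (\<forall>x y. (\<exists>j<n. y j \<noteq> 0) \<longrightarrow> 0 < ?h x y) \<longrightarrow> \<bar>det ?B\<bar> < det ?A)"
    if nz: "det ?A \<noteq> 0"
  proof -
    have dA: "det ?A > 0" using nz det_nn by simp
    obtain X where X: "X \<in> carrier_mat n n" and AX: "?A * X = sq_mat n (\<lambda>j k. - b j k)"
      using solve_matrix_equation[OF nz] by blast
    have AX': "?A * X = - ?B" unfolding AX by auto
    define c where "c j k = (X\<^sup>T * ?A * X) $$ (j, k)" for j k
    have cmat: "sq_mat n c = X\<^sup>T * ?A * X"
      using X by (intro eq_matI) (auto simp: c_def)
    have AT: "?A\<^sup>T = ?A" using sym by (intro eq_matI) auto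
    have "(X\<^sup>T * ?A * X)\<^sup>T = X\<^sup>T * ?A * X"
      using X transpose_mult[of "X\<^sup>T * ?A" n n X n] transpose_mult[of "X\<^sup>T" n n ?A n]
        assoc_mult_mat[of "X\<^sup>T" n n ?A n X n] by (simp add: AT)
    then have symc: "c j k = c k j" if "j < n" "k < n" for j k
      using that X unfolding c_def
      by (metis cmat dim_col_mat(1) dim_row_mat(1) index_transpose_mat(1))
    define w where "w y j = (X *\<^sub>v vec n y) $ j" for y j
    have qc: "quad_form n c y = quad_form n a (w y)" for y
      unfolding c_def w_def by (rule quad_form_congruence[OF X])
    \<comment> \<open>\<open>w y\<close> minimises \<open>x \<mapsto> h(x, y)\<close>, since \<open>a (w y) = - b y\<close>\<close>
    have gap: "?h (w y) y = quad_form n a y - quad_form n c y" for y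
    proof -
      have "(\<Sum>k<n. b j k * y k) = - (\<Sum>k<n. a j k * w y k)" if "j < n" for j
      proof -
        have "?A *\<^sub>v (X *\<^sub>v vec n y) = (- ?B) *\<^sub>v vec n y"
          using X by (subst assoc_mult_mat_vec[symmetric, of _ n n _ n]) (auto simp: AX')
        then have "(?A *\<^sub>v (X *\<^sub>v vec n y)) $ j = ((- ?B) *\<^sub>v vec n y) $ j" by simp
        then show ?thesis
          using that X by (simp add: scalar_prod_def w_def atLeast0LessThan sum_negf)
      qed
      then have "(\<Sum>j<n. w y j * (\<Sum>k<n. b j k * y k)) = - quad_form n a (w y)"
        by (simp add: quad_form_bilinear sum_negf)
      then show ?thesis by (simp add: qc)
    qed
    have c_nn: "0 \<le> quad_form n c y" for y using a_nn by (simp add: qc)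
    have le: "quad_form n c y \<le> quad_form n a y" for y
      using nonneg[of "w y" y] gap[of y] by linarith
    have detc: "det (sq_mat n c) = det ?A * (det X)\<^sup>2"
      unfolding cmat using X by (simp add: det_mult[of _ n] det_transpose power2_eq_square)
    have "det ?A * det X = det (- ?B)"
      using X det_mult[of ?A n X] by (simp add: AX')
    also have "- ?B = (-1) \<cdot>\<^sub>m ?B" by auto
    finally have "\<bar>det ?A * det X\<bar> = \<bar>det ?B\<bar>" by (simp add: abs_mult power_abs)
    then have detB: "\<bar>det ?B\<bar> = det ?A * \<bar>det X\<bar>" using dA by (simp add: abs_mult)
    have "det ?A * (det X)\<^sup>2 \<le> det ?A * 1"
      using det_mono_quad_form[OF symc sym c_nn le] detc by simp
    then have "(det X)\<^sup>2 \<le> 1" using dA by (rule mult_left_le_imp_le)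
    then have "\<bar>det X\<bar> \<le> 1" by (simp only: abs_square_le_1)
    moreover have "\<bar>det X\<bar> < 1" if n: "n \<ge> 1" and p: "\<forall>x y. (\<exists>j<n. y j \<noteq> 0) \<longrightarrow> 0 < ?h x y"
    proof -
      have less: "quad_form n c y < quad_form n a y" if "\<exists>j<n. y j \<noteq> 0" for y
      proof -
        have "0 < ?h (w y) y" using p that by blast
        then show ?thesis unfolding gap by simp
      qed
      have "det ?A * (det X)\<^sup>2 < det ?A * 1"
        using det_strict_mono_quad_form[OF symc sym c_nn less n] detc by simp
      then have "(det X)\<^sup>2 < 1" using det_nn by (rule mult_left_less_imp_less)
      then show ?thesis by (simp only: abs_square_less_1)
    qed
    ultimately show ?thesis
      unfolding detB using mult_left_mono[of "\<bar>det X\<bar>" 1 "det ?A"]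
        mult_strict_left_mono[of "\<bar>det X\<bar>" 1 "det ?A"] dA by simp
  qed
  show "\<bar>det ?B\<bar> \<le> det ?A"
    using singular regular by (cases "det ?A = 0") auto
  show "\<bar>det ?B\<bar> < det ?A"
    if "n \<ge> 1" "\<And>x y. \<exists>j<n. y j \<noteq> 0 \<Longrightarrow> 0 < ?h x y"
    using regular[OF pos[OF that(2)]] that by blast
qed

section \<open>Hermitian forms\<close>

lemma conj_cext_Cext: "conj_cext z = Cext (re_part z) (- im_part z)"
  by (simp add: conj_cext_def of_base_def imag_unit_def minus_cext_def times_cext_def)

lemma re_part_sum: "re_part (sum f A) = (\<Sum>i\<in>A. re_part (f i))"
  by (induction A rule: infinite_finite_induct) (auto simp: zero_cext_def plus_cext_def)

lemma hermitian_form_zero: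
  assumes "hermitian_form scale \<phi>"
  shows "\<phi> 0 w = 0" "\<phi> v 0 = 0"
proof -
  have "\<phi> (0 + 0) w = \<phi> 0 w + \<phi> 0 w" "\<phi> v (0 + 0) = \<phi> v 0 + \<phi> v 0"
    using assms unfolding hermitian_form_def by blast+
  then show "\<phi> 0 w = 0" "\<phi> v 0 = 0"
    by (simp_all only: add_0 add_cancel_right_right)
qed

lemma hermitian_form_sum:
  assumes "hermitian_form scale \<phi>"
  shows "\<phi> (\<Sum>j\<in>J. scale (c j) (e j)) (\<Sum>k\<in>K. scale (d k) (f k))
    = (\<Sum>j\<in>J. \<Sum>k\<in>K. conj_cext (c j) * d k * \<phi> (e j) (f k))"
proof -
  note zero = hermitian_form_zero[OF assms]
  have left: "\<phi> (\<Sum>j\<in>J. scale (c j) (e j)) w = (\<Sum>j\<in>J. conj_cext (c j) * \<phi> (e j) w)" for w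
    using assms by (induction J rule: infinite_finite_induct) (auto simp: zero hermitian_form_def)
  have right: "\<phi> v (\<Sum>k\<in>K. scale (d k) (f k)) = (\<Sum>k\<in>K. d k * \<phi> v (f k))" for v
    using assms by (induction K rule: infinite_finite_induct) (auto simp: zero hermitian_form_def)
  show ?thesis unfolding left by (simp add: right sum_distrib_left mult_ac)
qed

text \<open>
  Taking \<open>y\<close> for the real and \<open>x\<close> for the imaginary coordinates, the two mixed terms
  \<open>x\<^sup>T b y\<close> and \<open>- y\<^sup>T b x\<close> agree by skew-symmetry.
\<close>

lemma re_part_hermitian_form:
  fixes a b :: "nat \<Rightarrow> nat \<Rightarrow> 'a::linordered_field"
  assumes herm: "hermitian_form scale \<phi>"
    and entries: "\<And>j k. j < n \<Longrightarrow> k < n \<Longrightarrow> \<phi> (e j) (e k) = Cext (a j k) (b j k)"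
    and skew: "\<And>j k. j < n \<Longrightarrow> k < n \<Longrightarrow> b j k = - b k j"
  defines "v x y \<equiv> (\<Sum>j<n. scale (Cext (y j) (x j)) (e j))"
  shows "re_part (\<phi> (v x y) (v x y))
    = quad_form n a x + quad_form n a y + 2 * (\<Sum>j<n. x j * (\<Sum>k<n. b j k * y k))"
proof -
  have "re_part (\<phi> (v x y) (v x y)) = (\<Sum>j<n. \<Sum>k<n. x j * a j k * x k + y j * a j k * y k
      + x j * b j k * y k - y j * b j k * x k)"
    unfolding v_def hermitian_form_sum[OF herm] re_part_sum
    by (intro sum.cong refl)
      (simp add: entries conj_cext_Cext times_cext_def algebra_simps)
  also have "\<dots> = quad_form n a x + quad_form n a y + (\<Sum>j<n. \<Sum>k<n. x j * b j k * y k)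
      - (\<Sum>j<n. \<Sum>k<n. y j * b j k * x k)"
    by (simp add: quad_form_def sum.distrib sum_subtractf)
  also have "(\<Sum>j<n. \<Sum>k<n. y j * b j k * x k) = (\<Sum>k<n. \<Sum>j<n. y j * b j k * x k)"
    by (rule sum.swap)
  also have "\<dots> = - (\<Sum>j<n. \<Sum>k<n. x j * b j k * y k)"
    unfolding sum_negf[symmetric]
  proof (intro sum.cong refl)
    fix k j assume "k \<in> {..<n}" "j \<in> {..<n}"
    then show "y j * b j k * x k = - (x k * b k j * y j)" using skew[of j k] by simp
  qed
  finally show ?thesis by (simp add: sum_distrib_left mult_ac)
qed

theorem theorem4p1:
  fixes scale :: "'a::linordered_field cext \<Rightarrow> 'v::ab_group_add \<Rightarrow> 'v"
    and n :: nat
    and e :: "nat \<Rightarrow> 'v"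
    and \<phi> :: "'v \<Rightarrow> 'v \<Rightarrow> 'a cext"
    and a b :: "nat \<Rightarrow> nat \<Rightarrow> 'a"
  assumes "finite_dimensional_vector_space scale (e ` {..<n})"
    and "inj_on e {..<n}"
    and "hermitian_form scale \<phi>"
    and "nonneg_definite \<phi>"
    and "\<And>j k. j < n \<Longrightarrow> k < n \<Longrightarrow>
           \<phi> (e j) (e k) = of_base (a j k) + imag_unit * of_base (b j k)"
  shows "det (mat n n (\<lambda>(j, k). a j k)) \<ge> det (mat n n (\<lambda>(j, k). b j k))
    \<and> (n \<ge> 1 \<and> positive_definite \<phi> \<longrightarrow>
         det (mat n n (\<lambda>(j, k). a j k)) > det (mat n n (\<lambda>(j, k). b j k)))
    \<and> (det (mat n n (\<lambda>(j, k). a j k)) = 0 \<longrightarrow> det (mat n n (\<lambda>(j, k). b j k)) = 0)"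
proof -
  interpret finite_dimensional_vector_space scale "e ` {..<n}" by fact
  have entries: "\<phi> (e j) (e k) = Cext (a j k) (b j k)" if "j < n" "k < n" for j k
    using assms(5)[OF that]
    by (simp add: of_base_def imag_unit_def plus_cext_def times_cext_def)
  have "Cext (a k j) (b k j) = Cext (a j k) (- b j k)" if "j < n" "k < n" for j k
  proof -
    have "conj_cext (\<phi> (e j) (e k)) = \<phi> (e k) (e j)"
      using assms(3) unfolding hermitian_form_def by blast
    then show ?thesis using that by (simp add: entries conj_cext_Cext)
  qed
  then have sym: "a j k = a k j" and skew: "b j k = - b k j" if "j < n" "k < n" for j k
    using that by (metis cext.inject)+
  define v where "v x y = (\<Sum>j<n. scale (Cext (y j) (x j)) (e j))" for x y
  have re: "re_part (\<phi> (v x y) (v x y)) = quad_form n a x + quad_form n a y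
      + 2 * (\<Sum>j<n. x j * (\<Sum>k<n. b j k * y k))" for x y
    unfolding v_def by (rule re_part_hermitian_form[where \<phi> = \<phi> and e = e, OF assms(3) entries skew])
  have nonneg: "0 \<le> quad_form n a x + quad_form n a y
      + 2 * (\<Sum>j<n. x j * (\<Sum>k<n. b j k * y k))" for x y
  proof -
    obtain r where "r \<ge> 0" "\<phi> (v x y) (v x y) = of_base r"
      using assms(4) unfolding nonneg_definite_def by blast
    then show ?thesis using re[where x = x and y = y] by (simp add: of_base_def)
  qed
  have le: "\<bar>det (sq_mat n b)\<bar> \<le> det (sq_mat n a)"
    by (rule abs_det_imag_le_det_real(1)[OF sym nonneg])
  have less: "\<bar>det (sq_mat n b)\<bar> < det (sq_mat n a)" if n: "n \<ge> 1" and pd: "positive_definite \<phi>"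
  proof (rule abs_det_imag_le_det_real(2)[OF sym nonneg n])
    fix x y assume "\<exists>j<n. y j \<noteq> (0::'a)"
    then obtain j where j: "j < n" "y j \<noteq> 0" by blast
    have "v x y \<noteq> 0"
    proof
      \<comment> \<open>the coordinates of \<open>v x y\<close> as a function on the set of basis vectors\<close>
      define u where "u w = (let j = the_inv_into {..<n} e w in Cext (y j) (x j))" for w
      have ue: "u (e j) = Cext (y j) (x j)" if "j < n" for j
        using assms(2) that by (simp add: u_def the_inv_into_f_f)
      assume "v x y = 0"
      then have "(\<Sum>w\<in>e ` {..<n}. scale (u w) w) = 0"
        by (simp add: sum.reindex[OF assms(2)] ue v_def)
      then have "u (e j) = 0"
        using independentD[OF independent_Basis finite_Basis order_refl] j(1) by blast
      then show False using j by (simp add: ue zero_cext_def)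
    qed
    then obtain r where "r > 0" "\<phi> (v x y) (v x y) = of_base r"
      using pd unfolding positive_definite_def by blast
    then show "0 < quad_form n a x + quad_form n a y
      + 2 * (\<Sum>j<n. x j * (\<Sum>k<n. b j k * y k))" using re[where x = x and y = y] by (simp add: of_base_def)
  qed
  show ?thesis
  proof (intro conjI impI)
    show "det (sq_mat n b) \<le> det (sq_mat n a)" using le by (rule abs_le_D1)
    show "det (sq_mat n b) < det (sq_mat n a)" if "n \<ge> 1 \<and> positive_definite \<phi>"
      using less that abs_ge_self le_less_trans by blast
    show "det (sq_mat n b) = 0" if "det (sq_mat n a) = 0"
      using le unfolding that by (simp only: abs_le_zero_iff)
  qed
qed

end
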